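(* For every field $K$ of characteristic $3$, there exists a 2-nilpotent Lie algebra $\mathfrak{g}$ over $K$ (i.e. $[\mathfrak{g},[\mathfrak{g},\mathfrak{g}]]=\{0\}$) whose reduced Koszul map $\bar\eta:H_3(\mathfrak{g})\to\mathrm{Kill}(\mathfrak{g})$ is nonzero.
   Context: Tensor, exterior and symmetric powers are over $K$. $H_*(\mathfrak{g})$ is the homology of the Chevalley–Eilenberg complex $\Lambda^*\mathfrak{g}$ with $\partial_n(x_1\wedge\dots\wedge x_n)=\sum_{i<j}(-1)^{i+j}[x_i,x_j]\wedge x_1\wedge\dots\wedge\hat{x_i}\wedge\dots\wedge\hat{x_j}\wedge\dots\wedge x_n$, and $Z_3(\mathfrak{g})=\ker\partial_3$. Writing $x\odot y$ for the product in the symmetric square $S^2\mathfrak{g}$, the Killing module $\mathrm{Kill}(\mathfrak{g})$ is the cokernel of $\mathfrak{g}^{\otimes 3}\to S^2\mathfrak{g}$, $x\otimes y\otimes z\mapsto [x,y]\odot z-x\odot[y,z]$. The Koszul map $\eta:\Lambda^3\mathfrak{g}\to\mathrm{Kill}(\mathfrak{g})$ sends $x\wedge y\wedge z$ to the class of $x\odot[y,z]$; it vanishes on 3-boundaries, and the reduced Koszul map $\bar\eta:H_3(\mathfrak{g})\to\mathrm{Kill}(\mathfrak{g})$ is induced by restricting $\eta$ to $Z_3(\mathfrak{g})$. *)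

theory Defs
  imports "HOL-Library.Poly_Mapping" "HOL-Library.Set_Algebras"
    "HOL-Computational_Algebra.Computational_Algebra"
begin

text \<open>
  The type \<open>'x \<Rightarrow>\<^sub>0 'k\<close> of finitely supported functions is the \<open>'k\<close>-vector space with
  basis \<open>'x\<close>, a basis vector being \<open>Poly_Mapping.single x 1\<close>.
\<close>

definition fscale :: "'k::field \<Rightarrow> ('x \<Rightarrow>\<^sub>0 'k) \<Rightarrow> ('x \<Rightarrow>\<^sub>0 'k)"
  where "fscale c = Poly_Mapping.map (\<lambda>a. c * a)"

lemma lookup_fscale [simp]: "Poly_Mapping.lookup (fscale c p) x = c * Poly_Mapping.lookup p x"
  by (auto simp: fscale_def map.rep_eq when_def)

interpretation free: vector_space fscale
  by unfold_locales (auto intro!: poly_mapping_eqI simp: lookup_add algebra_simps)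

abbreviation basis_vec :: "'x \<Rightarrow> ('x \<Rightarrow>\<^sub>0 'k::field)"
  where "basis_vec x \<equiv> Poly_Mapping.single x 1"

definition free_on :: "'x set \<Rightarrow> ('x \<Rightarrow>\<^sub>0 'k::field) set"
  where "free_on X = {p. Poly_Mapping.keys p \<subseteq> X}"

definition lin_ext :: "('x \<Rightarrow> ('y \<Rightarrow>\<^sub>0 'k)) \<Rightarrow> ('x \<Rightarrow>\<^sub>0 'k::field) \<Rightarrow> ('y \<Rightarrow>\<^sub>0 'k)"
  where "lin_ext f p = (\<Sum>x\<in>Poly_Mapping.keys p. fscale (Poly_Mapping.lookup p x) (f x))"

text \<open>
  The quotient of \<open>V\<close> by a subspace \<open>W\<close> is the set of cosets \<open>v +o W\<close>, so the zero vector of the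
  quotient is \<open>W\<close>. Since the sum of two cosets is their elementwise sum, i.e. the addition
  on sets of \<^theory>\<open>HOL-Library.Set_Algebras\<close>, the same definition applies again when the vectors
  of \<open>V\<close> are themselves cosets.
  A map \<open>f\<close> that is constant on cosets induces \<open>\<lambda>c. the_elem (f ` c)\<close> on the quotient.
\<close>

definition quot :: "'a::plus set \<Rightarrow> 'a set \<Rightarrow> 'a set set"
  where "quot V W = (\<lambda>v. v +o W) ` V"

definition qmap :: "('a \<Rightarrow> 'b) \<Rightarrow> 'a set \<Rightarrow> 'b"
  where "qmap f c = the_elem (f ` c)"

text \<open>
  \<open>L\<close> is a subspace of a vector space with scalar multiplication \<open>scale\<close>. The list
  \<open>[x\<^sub>1, \<dots>, x\<^sub>n]\<close>, as a basis vector of the free vector space on \<open>words L n\<close>, represents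
  \<open>x\<^sub>1 \<otimes> \<dots> \<otimes> x\<^sub>n\<close>, \<open>x\<^sub>1 \<and> \<dots> \<and> x\<^sub>n\<close> and (for \<open>n = 2\<close>) \<open>x\<^sub>1 \<odot> x\<^sub>2\<close> respectively.
\<close>

definition words :: "'v set \<Rightarrow> nat \<Rightarrow> 'v list set"
  where "words L n = {xs. length xs = n \<and> set xs \<subseteq> L}"

definition multilinear_rels ::
    "('k::field \<Rightarrow> 'v::ab_group_add \<Rightarrow> 'v) \<Rightarrow> 'v set \<Rightarrow> nat \<Rightarrow> ('v list \<Rightarrow>\<^sub>0 'k) set"
  where "multilinear_rels scale L n =
    {basis_vec (us @ (x + y) # vs) - basis_vec (us @ x # vs) - basis_vec (us @ y # vs) | us x y vs.
       us @ x # vs \<in> words L n \<and> y \<in> L} \<union>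
    {basis_vec (us @ scale c x # vs) - fscale c (basis_vec (us @ x # vs)) | us c x vs.
       us @ x # vs \<in> words L n}"

definition tensor_rel ::
    "('k::field \<Rightarrow> 'v::ab_group_add \<Rightarrow> 'v) \<Rightarrow> 'v set \<Rightarrow> nat \<Rightarrow> ('v list \<Rightarrow>\<^sub>0 'k) set"
  where "tensor_rel scale L n = free.span (multilinear_rels scale L n)"

definition ext_rel ::
    "('k::field \<Rightarrow> 'v::ab_group_add \<Rightarrow> 'v) \<Rightarrow> 'v set \<Rightarrow> nat \<Rightarrow> ('v list \<Rightarrow>\<^sub>0 'k) set"
  where "ext_rel scale L n =
    free.span (multilinear_rels scale L n \<union> {basis_vec xs | xs. xs \<in> words L n \<and> \<not> distinct xs})"

definition sym2_rel ::
    "('k::field \<Rightarrow> 'v::ab_group_add \<Rightarrow> 'v) \<Rightarrow> 'v set \<Rightarrow> ('v list \<Rightarrow>\<^sub>0 'k) set"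
  where "sym2_rel scale L =
    free.span (multilinear_rels scale L 2 \<union>
      {basis_vec [x, y] - basis_vec [y, x] | x y. x \<in> L \<and> y \<in> L})"

definition tensor_power ::
    "('k::field \<Rightarrow> 'v::ab_group_add \<Rightarrow> 'v) \<Rightarrow> 'v set \<Rightarrow> nat \<Rightarrow> ('v list \<Rightarrow>\<^sub>0 'k) set set"
  where "tensor_power scale L n = quot (free_on (words L n)) (tensor_rel scale L n)"

definition ext_power ::
    "('k::field \<Rightarrow> 'v::ab_group_add \<Rightarrow> 'v) \<Rightarrow> 'v set \<Rightarrow> nat \<Rightarrow> ('v list \<Rightarrow>\<^sub>0 'k) set set"
  where "ext_power scale L n = quot (free_on (words L n)) (ext_rel scale L n)"

definition sym_square ::
    "('k::field \<Rightarrow> 'v::ab_group_add \<Rightarrow> 'v) \<Rightarrow> 'v set \<Rightarrow> ('v list \<Rightarrow>\<^sub>0 'k) set set"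
  where "sym_square scale L = quot (free_on (words L 2)) (sym2_rel scale L)"

text \<open>
  A Lie algebra is carried by a subspace \<open>L\<close> of an ambient vector space; the values of the
  bracket outside \<open>L\<close> are irrelevant. Up to isomorphism, every Lie algebra of countable
  dimension over \<open>'k\<close> arises with ambient type \<open>nat \<Rightarrow>\<^sub>0 'k\<close>.
\<close>

locale lie_algebra = vector_space scale
  for scale :: "'k::field \<Rightarrow> 'v::ab_group_add \<Rightarrow> 'v" +
  fixes L :: "'v set" and br :: "'v \<Rightarrow> 'v \<Rightarrow> 'v"
  assumes subspace_L: "subspace L"
    and br_closed: "x \<in> L \<Longrightarrow> y \<in> L \<Longrightarrow> br x y \<in> L"
    and br_add_left: "x \<in> L \<Longrightarrow> y \<in> L \<Longrightarrow> z \<in> L \<Longrightarrow> br (x + y) z = br x z + br y z"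
    and br_add_right: "x \<in> L \<Longrightarrow> y \<in> L \<Longrightarrow> z \<in> L \<Longrightarrow> br x (y + z) = br x y + br x z"
    and br_scale_left: "x \<in> L \<Longrightarrow> y \<in> L \<Longrightarrow> br (scale c x) y = scale c (br x y)"
    and br_scale_right: "x \<in> L \<Longrightarrow> y \<in> L \<Longrightarrow> br x (scale c y) = scale c (br x y)"
    and br_self: "x \<in> L \<Longrightarrow> br x x = 0"
    and jacobi: "x \<in> L \<Longrightarrow> y \<in> L \<Longrightarrow> z \<in> L \<Longrightarrow>
      br x (br y z) + br y (br z x) + br z (br x y) = 0"

definition lie_product ::
    "('k::field \<Rightarrow> 'v::ab_group_add \<Rightarrow> 'v) \<Rightarrow> ('v \<Rightarrow> 'v \<Rightarrow> 'v) \<Rightarrow> 'v set \<Rightarrow> 'v set \<Rightarrow> 'v set"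
  where "lie_product scale br A B = module.span scale {br a b | a b. a \<in> A \<and> b \<in> B}"

text \<open>
  Lists are indexed from 0, which leaves the sign \<open>(-1) ^ (i + j)\<close> unchanged. For \<open>n = 0\<close> the
  sum is empty, so the boundary is the zero map into \<open>\<Lambda>\<^sup>0\<close> instead of into the zero space,
  which does not affect cycles or homology.
\<close>

definition ce_word :: "('v \<Rightarrow> 'v \<Rightarrow> 'v) \<Rightarrow> 'v list \<Rightarrow> ('v list \<Rightarrow>\<^sub>0 'k::field)"
  where "ce_word br xs =
    (\<Sum>(i, j) \<in> {(i, j). i < j \<and> j < length xs}.
       fscale ((-1) ^ (i + j)) (basis_vec (br (xs ! i) (xs ! j) # nths xs (- {i, j}))))"

definition ce_boundary ::
    "('k::field \<Rightarrow> 'v::ab_group_add \<Rightarrow> 'v) \<Rightarrow> 'v set \<Rightarrow> ('v \<Rightarrow> 'v \<Rightarrow> 'v) \<Rightarrow> nat \<Rightarrow>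
      ('v list \<Rightarrow>\<^sub>0 'k) set \<Rightarrow> ('v list \<Rightarrow>\<^sub>0 'k) set"
  where "ce_boundary scale L br n = qmap (\<lambda>p. lin_ext (ce_word br) p +o ext_rel scale L (n - 1))"

definition ce_cycles ::
    "('k::field \<Rightarrow> 'v::ab_group_add \<Rightarrow> 'v) \<Rightarrow> 'v set \<Rightarrow> ('v \<Rightarrow> 'v \<Rightarrow> 'v) \<Rightarrow> nat \<Rightarrow>
      ('v list \<Rightarrow>\<^sub>0 'k) set set"
  where "ce_cycles scale L br n =
    {c \<in> ext_power scale L n. ce_boundary scale L br n c = ext_rel scale L (n - 1)}"

definition ce_boundaries ::
    "('k::field \<Rightarrow> 'v::ab_group_add \<Rightarrow> 'v) \<Rightarrow> 'v set \<Rightarrow> ('v \<Rightarrow> 'v \<Rightarrow> 'v) \<Rightarrow> nat \<Rightarrow>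
      ('v list \<Rightarrow>\<^sub>0 'k) set set"
  where "ce_boundaries scale L br n = ce_boundary scale L br (Suc n) ` ext_power scale L (Suc n)"

definition lie_homology ::
    "('k::field \<Rightarrow> 'v::ab_group_add \<Rightarrow> 'v) \<Rightarrow> 'v set \<Rightarrow> ('v \<Rightarrow> 'v \<Rightarrow> 'v) \<Rightarrow> nat \<Rightarrow>
      ('v list \<Rightarrow>\<^sub>0 'k) set set set"
  where "lie_homology scale L br n = quot (ce_cycles scale L br n) (ce_boundaries scale L br n)"

definition kill_map ::
    "('k::field \<Rightarrow> 'v::ab_group_add \<Rightarrow> 'v) \<Rightarrow> 'v set \<Rightarrow> ('v \<Rightarrow> 'v \<Rightarrow> 'v) \<Rightarrow>
      ('v list \<Rightarrow>\<^sub>0 'k) set \<Rightarrow> ('v list \<Rightarrow>\<^sub>0 'k) set"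
  where "kill_map scale L br = qmap (\<lambda>p.
    lin_ext (\<lambda>xs. basis_vec [br (xs ! 0) (xs ! 1), xs ! 2] - basis_vec [xs ! 0, br (xs ! 1) (xs ! 2)]) p
      +o sym2_rel scale L)"

definition kill_image ::
    "('k::field \<Rightarrow> 'v::ab_group_add \<Rightarrow> 'v) \<Rightarrow> 'v set \<Rightarrow> ('v \<Rightarrow> 'v \<Rightarrow> 'v) \<Rightarrow> ('v list \<Rightarrow>\<^sub>0 'k) set set"
  where "kill_image scale L br = kill_map scale L br ` tensor_power scale L 3"

definition Kill ::
    "('k::field \<Rightarrow> 'v::ab_group_add \<Rightarrow> 'v) \<Rightarrow> 'v set \<Rightarrow> ('v \<Rightarrow> 'v \<Rightarrow> 'v) \<Rightarrow>
      ('v list \<Rightarrow>\<^sub>0 'k) set set set"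
  where "Kill scale L br = quot (sym_square scale L) (kill_image scale L br)"

definition Kill_zero ::
    "('k::field \<Rightarrow> 'v::ab_group_add \<Rightarrow> 'v) \<Rightarrow> 'v set \<Rightarrow> ('v \<Rightarrow> 'v \<Rightarrow> 'v) \<Rightarrow>
      ('v list \<Rightarrow>\<^sub>0 'k) set set"
  where "Kill_zero scale L br = sym2_rel scale L +o kill_image scale L br"

definition koszul_map ::
    "('k::field \<Rightarrow> 'v::ab_group_add \<Rightarrow> 'v) \<Rightarrow> 'v set \<Rightarrow> ('v \<Rightarrow> 'v \<Rightarrow> 'v) \<Rightarrow>
      ('v list \<Rightarrow>\<^sub>0 'k) set \<Rightarrow> ('v list \<Rightarrow>\<^sub>0 'k) set set"
  where "koszul_map scale L br = qmap (\<lambda>p.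
    (lin_ext (\<lambda>xs. basis_vec [xs ! 0, br (xs ! 1) (xs ! 2)]) p +o sym2_rel scale L)
      +o kill_image scale L br)"

definition reduced_koszul_map ::
    "('k::field \<Rightarrow> 'v::ab_group_add \<Rightarrow> 'v) \<Rightarrow> 'v set \<Rightarrow> ('v \<Rightarrow> 'v \<Rightarrow> 'v) \<Rightarrow>
      ('v list \<Rightarrow>\<^sub>0 'k) set set \<Rightarrow> ('v list \<Rightarrow>\<^sub>0 'k) set set"
  where "reduced_koszul_map scale L br = qmap (koszul_map scale L br)"

end

theory Submission
  imports Defs
begin

text \<open>
  Let \<open>\<tau>\<close> be the alternating trilinear form on \<open>V = K\<^sup>7\<close> with \<open>\<tau>(e\<^sub>i, e\<^sub>i\<^sub>+\<^sub>1, e\<^sub>i\<^sub>+\<^sub>3) = 1\<close> for the seven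
  lines \<open>{i, i + 1, i + 3}\<close> of the Fano plane, and put \<open>\<gg> = V \<oplus> V\<^sup>*\<close> with \<open>[x, y] = \<tau>(x, y, -)\<close> on
  \<open>V\<close> and \<open>V\<^sup>*\<close> central. The boundary of \<open>\<omega> = \<Sum> e\<^sub>i \<and> e\<^sub>i\<^sub>+\<^sub>1 \<and> e\<^sub>i\<^sub>+\<^sub>3\<close> is \<open>-3 \<Sum> e\<^sub>i\<^sup>* \<and> e\<^sub>i\<close>, since each point
  lies on three lines, so \<open>\<omega>\<close> is a cycle in characteristic 3. The canonical pairing of \<open>V\<close> and
  \<open>V\<^sup>*\<close> is an invariant symmetric form on \<open>\<gg>\<close>, hence a functional on \<open>Kill(\<gg>)\<close>, and its value on
  the Koszul image of \<open>\<omega>\<close> is the number 7 of lines, which is nonzero in \<open>K\<close>.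
\<close>

section \<open>Functionals on free vector spaces\<close>

text \<open>The linear functional with value \<open>f x\<close> on the basis vector of
  \<open>x\<close>; every functional on the free space has this form.\<close>

definition pairing :: "('x \<Rightarrow> 'k::field) \<Rightarrow> ('x \<Rightarrow>\<^sub>0 'k) \<Rightarrow> 'k"
  where "pairing f p = (\<Sum>x\<in>Poly_Mapping.keys p. Poly_Mapping.lookup p x * f x)"

lemma pairing_superset:
  assumes "finite A" "Poly_Mapping.keys p \<subseteq> A"
  shows "pairing f p = (\<Sum>x\<in>A. Poly_Mapping.lookup p x * f x)"
  unfolding pairing_def using assms by (intro sum.mono_neutral_left) (auto simp: in_keys_iff)

lemma pairing_zero [simp]: "pairing f 0 = 0"
  by (simp add: pairing_def)

lemma pairing_zero_fun [simp]: "pairing (\<lambda>_. 0) p = 0"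
  by (simp add: pairing_def)

lemma pairing_single [simp]: "pairing f (Poly_Mapping.single x c) = c * f x"
  by (cases "c = 0") (simp_all add: pairing_def)

lemma pairing_add [simp]: "pairing f (p + q) = pairing f p + pairing f q"
proof -
  let ?A = "Poly_Mapping.keys p \<union> Poly_Mapping.keys q"
  have "Poly_Mapping.keys (p + q) \<subseteq> ?A" by (rule Poly_Mapping.keys_add)
  then show ?thesis
    by (simp add: pairing_superset[of ?A] lookup_add ring_distribs sum.distrib)
qed

lemma pairing_fscale [simp]: "pairing f (fscale c p) = c * pairing f p"
proof -
  have "Poly_Mapping.keys (fscale c p) \<subseteq> Poly_Mapping.keys p" by (auto simp: in_keys_iff)
  then show ?thesis
    by (simp add: pairing_superset[of "Poly_Mapping.keys p"] sum_distrib_left mult.assoc)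
qed

lemma pairing_uminus [simp]: "pairing f (- p) = - pairing f p"
  by (metis pairing_add pairing_zero add.right_inverse add_eq_0_iff)

lemma pairing_diff [simp]: "pairing f (p - q) = pairing f p - pairing f q"
  using pairing_add[of f p "- q"] by simp

lemma pairing_sum [simp]: "pairing f (sum g I) = (\<Sum>i\<in>I. pairing f (g i))"
  by (induction I rule: infinite_finite_induct) simp_all

lemma pairing_lin_ext [simp]: "pairing f (lin_ext h p) = pairing (\<lambda>x. pairing f (h x)) p"
  by (simp add: lin_ext_def pairing_def[of _ p])

lemma poly_mapping_eq_sum: "p = (\<Sum>x\<in>Poly_Mapping.keys p. fscale (Poly_Mapping.lookup p x) (basis_vec x))"
  by (rule poly_mapping_eqI) (simp add: lookup_sum lookup_single when_def in_keys_iff if_distrib cong: if_cong)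

lemma pairing_cong: "(\<And>x. x \<in> Poly_Mapping.keys p \<Longrightarrow> f x = g x) \<Longrightarrow> pairing f p = pairing g p"
  by (simp add: pairing_def)

text \<open>Coordinates are themselves pairings, so functionals separate vectors. Identities of
  vectors then reduce to arithmetic in the field.\<close>

lemma poly_mapping_eqI_pairing:
  assumes "\<And>f. pairing f p = pairing f q"
  shows "p = q"
proof (rule poly_mapping_eqI)
  have "pairing (\<lambda>y. if y = x then 1 else 0) r = Poly_Mapping.lookup r x" for r :: "'a \<Rightarrow>\<^sub>0 'b" and x
    by (simp add: pairing_def in_keys_iff if_distrib cong: if_cong)
  then show "Poly_Mapping.lookup p x = Poly_Mapping.lookup q x" for x
    using assms by metis
qed

lemma lin_ext_add [simp]: "lin_ext h (p + q) = lin_ext h p + lin_ext h q"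
  by (rule poly_mapping_eqI_pairing) simp

lemma lin_ext_diff [simp]: "lin_ext h (p - q) = lin_ext h p - lin_ext h q"
  by (rule poly_mapping_eqI_pairing) simp

lemma lin_ext_fscale [simp]: "lin_ext h (fscale c p) = fscale c (lin_ext h p)"
  by (rule poly_mapping_eqI_pairing) simp

lemma lin_ext_zero [simp]: "lin_ext h 0 = 0"
  by (simp add: lin_ext_def)

lemma lin_ext_basis_vec [simp]: "lin_ext h (basis_vec x) = h x"
  by (rule poly_mapping_eqI_pairing) simp

lemma pairing_span:
  assumes "\<And>g. g \<in> G \<Longrightarrow> pairing f g = 0" "p \<in> free.span G"
  shows "pairing f p = 0"
  using assms(2) by (induction rule: free.span_induct_alt) (auto simp: assms(1))

text \<open>
  Congruences modulo a span of relations thus become equations in the field, for all functionals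
  that kill the relations.
\<close>

lemma in_span_pairingI:
  fixes p :: "'x \<Rightarrow>\<^sub>0 'k::field"
  assumes "\<And>f. (\<And>g. g \<in> G \<Longrightarrow> pairing f g = 0) \<Longrightarrow> pairing f p = 0"
  shows "p \<in> free.span G"
proof (rule ccontr)
  assume p: "p \<notin> free.span G"
  \<comment> \<open>If \<open>p\<close> is outside the span, adjoining it to a basis
    \<open>B\<close> of the span yields a functional that is 1 at \<open>p\<close> and 0 on
    \<open>B\<close>.\<close>
  obtain B where B: "B \<subseteq> free.span G" "free.independent B" "free.span G \<subseteq> free.span B"
    using free.maximal_independent_subset by blast
  then have "free.span B \<subseteq> free.span G"
    by (simp add: free.span_minimal)
  with p B have ind: "free.independent (insert p B)" and "p \<notin> B"
    by (auto simp: free.independent_insert free.span_base)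
  interpret vector_space_pair "fscale :: 'k \<Rightarrow> ('x \<Rightarrow>\<^sub>0 'k) \<Rightarrow> _" "(*) :: 'k \<Rightarrow> 'k \<Rightarrow> 'k"
    by unfold_locales (simp_all add: ring_distribs)
  obtain \<pi> where \<pi>: "Vector_Spaces.linear fscale (*) \<pi>" and "\<And>x. x \<in> insert p B \<Longrightarrow> \<pi> x = (if x = p then 1 else 0)"
    using linear_independent_extend[OF ind, of "\<lambda>x. if x = p then 1 else 0"] by blast
  with \<open>p \<notin> B\<close> have \<pi>p: "\<pi> p = 1" and \<pi>B: "\<And>x. x \<in> B \<Longrightarrow> \<pi> x = 0" by auto
  interpret \<pi>: Vector_Spaces.linear fscale "(*)" \<pi> by (fact \<pi>)
  \<comment> \<open>A linear functional is the pairing with its own values on basis vectors, so the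
    hypothesis applies to \<open>\<pi>\<close>.\<close>
  have eq: "\<pi> q = pairing (\<lambda>x. \<pi> (basis_vec x)) q" for q
    by (subst (1) poly_mapping_eq_sum[of q]) (simp only: \<pi>.sum \<pi>.scale pairing_def)
  have "\<pi> q = 0" if "q \<in> G" for q
  proof -
    have "q \<in> free.span B" using B that free.span_base by blast
    then show ?thesis
      using pairing_span[of B "\<lambda>x. \<pi> (basis_vec x)" q] \<pi>B by (simp only: eq[symmetric])
  qed
  then have "pairing (\<lambda>x. \<pi> (basis_vec x)) p = 0"
    by (intro assms) (simp only: eq[symmetric])
  then have "\<pi> p = 0" by (simp only: eq[symmetric])
  with \<pi>p show False by simp
qed

section \<open>Cosets and maps induced on quotients\<close>

lemma subspace_set_plus:
  assumes "free.subspace W"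
  shows "W + W = W"
proof
  show "W + W \<subseteq> W" using assms by (auto simp: set_plus_def free.subspace_add)
  show "W \<subseteq> W + W" using assms by (metis free.subspace_0 set_zero_plus2)
qed

lemma coset_plus_coset:
  assumes "free.subspace W"
  shows "(a +o W) + (b +o W) = (a + b) +o W"
  by (simp add: set_plus_rearrange subspace_set_plus assms)

lemma coset_eq_iff:
  assumes "free.subspace W"
  shows "a +o W = b +o W \<longleftrightarrow> a - b \<in> W"
proof
  assume "a +o W = b +o W"
  moreover have "a \<in> a +o W"
    using set_plus_intro2[of 0 W a] assms by (simp add: free.subspace_0)
  ultimately show "a - b \<in> W" by (simp add: set_minus_plus)
next
  assume d: "a - b \<in> W"
  have "a +o W = b +o ((a - b) +o W)" by (simp add: set_plus_rearrange2)
  also have "(a - b) +o W = W"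
  proof
    show "(a - b) +o W \<subseteq> W"
      using d assms by (auto simp: elt_set_plus_def free.subspace_add)
    show "W \<subseteq> (a - b) +o W"
      using d assms by (metis free.subspace_diff set_minus_plus subsetI)
  qed
  finally show "a +o W = b +o W" .
qed

lemma qmap_eqI:
  assumes "A \<noteq> {}" "\<And>a. a \<in> A \<Longrightarrow> f a = y"
  shows "qmap f A = y"
proof -
  have "f ` A = {y}" using assms by auto
  then show ?thesis by (simp add: qmap_def)
qed

text \<open>\<open>the_elem\<close> is meaningful only on singletons; invariance under
  \<open>W\<close> makes the image of the coset one.\<close>

lemma qmap_coset:
  assumes "free.subspace W" "\<And>w. w \<in> W \<Longrightarrow> f (v + w) = f v"
  shows "qmap f (v +o W) = f v"
  using assms free.subspace_0[OF assms(1)]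
  by (intro qmap_eqI) (auto simp: elt_set_plus_def)

section \<open>Multilinear and alternating functionals\<close>

text \<open>The splittings of a short word are listed slot by slot, so that multilinearity becomes
  linearity in each argument.\<close>

lemma all_words_append_Cons_2:
  "(\<forall>us x vs. us @ x # vs \<in> words L 2 \<longrightarrow> P us x vs) \<longleftrightarrow> (\<forall>x\<in>L. \<forall>y\<in>L. P [] x [y] \<and> P [x] y [])"
proof -
  have "us @ x # vs \<in> words L 2 \<longleftrightarrow>
      x \<in> L \<and> (\<exists>a\<in>L. us = [] \<and> vs = [a] \<or> us = [a] \<and> vs = [])" for us x vs
    by (cases us) (auto simp: words_def length_Suc_conv)
  then show ?thesis by (simp only:) blast
qed

lemma all_words_append_Cons_3:
  "(\<forall>us x vs. us @ x # vs \<in> words L 3 \<longrightarrow> P us x vs) \<longleftrightarrow>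
    (\<forall>x\<in>L. \<forall>y\<in>L. \<forall>z\<in>L. P [] x [y, z] \<and> P [x] y [z] \<and> P [x, y] z [])"
proof -
  have "us @ x # vs \<in> words L 3 \<longleftrightarrow> x \<in> L \<and> (\<exists>a\<in>L. \<exists>b\<in>L.
      us = [] \<and> vs = [a, b] \<or> us = [a] \<and> vs = [b] \<or> us = [a, b] \<and> vs = [])" for us x vs
    \<comment> \<open>The case rule of \<open>remdups_adj\<close> serves as a split into empty,
      one-element and longer lists.\<close>
    by (cases us rule: remdups_adj.cases)
      (auto simp: words_def length_Suc_conv eval_nat_numeral append_eq_Cons_conv)
  then show ?thesis by (simp only:) blast
qed

lemma all_words_append_Cons_4:
  "(\<forall>us x vs. us @ x # vs \<in> words L 4 \<longrightarrow> P us x vs) \<longleftrightarrow>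
    (\<forall>x\<in>L. \<forall>y\<in>L. \<forall>z\<in>L. \<forall>w\<in>L.
      P [] x [y, z, w] \<and> P [x] y [z, w] \<and> P [x, y] z [w] \<and> P [x, y, z] w [])"
proof -
  have "us @ x # vs \<in> words L 4 \<longleftrightarrow> x \<in> L \<and> (\<exists>a\<in>L. \<exists>b\<in>L. \<exists>c\<in>L.
      us = [] \<and> vs = [a, b, c] \<or> us = [a] \<and> vs = [b, c] \<or>
      us = [a, b] \<and> vs = [c] \<or> us = [a, b, c] \<and> vs = [])" for us x vs
    by (cases us rule: remdups_adj.cases)
      (auto simp: words_def length_Suc_conv eval_nat_numeral append_eq_Cons_conv)
  then show ?thesis by (simp only:) blast
qed

lemma words_3: "xs \<in> words L 3 \<longleftrightarrow> (\<exists>a\<in>L. \<exists>b\<in>L. \<exists>c\<in>L. xs = [a, b, c])"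
  by (auto simp: words_def length_Suc_conv eval_nat_numeral)

lemma words_4: "xs \<in> words L 4 \<longleftrightarrow> (\<exists>a\<in>L. \<exists>b\<in>L. \<exists>c\<in>L. \<exists>d\<in>L. xs = [a, b, c, d])"
  by (auto simp: words_def length_Suc_conv eval_nat_numeral)

text \<open>Restricted to \<open>words L n\<close>, these are the functionals on the tensor
  power.\<close>

definition multilinear_on ::
    "('k::field \<Rightarrow> 'v::ab_group_add \<Rightarrow> 'v) \<Rightarrow> 'v set \<Rightarrow> nat \<Rightarrow> ('v list \<Rightarrow> 'k) \<Rightarrow> bool"
  where "multilinear_on scale L n f \<longleftrightarrow> (\<forall>us x vs. us @ x # vs \<in> words L n \<longrightarrow>
    (\<forall>y\<in>L. f (us @ (x + y) # vs) = f (us @ x # vs) + f (us @ y # vs)) \<and>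
    (\<forall>c. f (us @ scale c x # vs) = c * f (us @ x # vs)))"

lemma pairing_multilinear_rels_eq_0_iff:
  "(\<forall>g\<in>multilinear_rels scale L n. pairing f g = 0) \<longleftrightarrow> multilinear_on scale L n f"
proof -
  have "(\<forall>g\<in>multilinear_rels scale L n. pairing f g = 0) \<longleftrightarrow>
    (\<forall>us x y vs. us @ x # vs \<in> words L n \<and> y \<in> L \<longrightarrow>
      f (us @ (x + y) # vs) - f (us @ x # vs) - f (us @ y # vs) = 0) \<and>
    (\<forall>us c x vs. us @ x # vs \<in> words L n \<longrightarrow>
      f (us @ scale c x # vs) - c * f (us @ x # vs) = 0)"
    unfolding multilinear_rels_def ball_Un by (intro conj_cong; force)
  also have "\<dots> \<longleftrightarrow> multilinear_on scale L n f"
    unfolding multilinear_on_def diff_diff_eq right_minus_eq by blast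
  finally show ?thesis .
qed

definition alternating_on ::
    "('k::field \<Rightarrow> 'v::ab_group_add \<Rightarrow> 'v) \<Rightarrow> 'v set \<Rightarrow> nat \<Rightarrow> ('v list \<Rightarrow> 'k) \<Rightarrow> bool"
  where "alternating_on scale L n f \<longleftrightarrow>
    multilinear_on scale L n f \<and> (\<forall>xs\<in>words L n. \<not> distinct xs \<longrightarrow> f xs = 0)"

lemma pairing_ext_rel:
  assumes "alternating_on scale L n f" "p \<in> ext_rel scale L n"
  shows "pairing f p = 0"
  using _ assms(2) unfolding ext_rel_def
proof (rule pairing_span)
  show "pairing f g = 0"
    if "g \<in> multilinear_rels scale L n \<union> {basis_vec xs |xs. xs \<in> words L n \<and> \<not> distinct xs}" for g
    using assms(1) that by (auto simp: alternating_on_def simp flip: pairing_multilinear_rels_eq_0_iff)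
qed

text \<open>A subspace equals its double annihilator, so a chain is zero in the exterior power once
  all alternating functionals vanish on it.\<close>

lemma in_ext_relI:
  assumes "\<And>f. alternating_on scale L n f \<Longrightarrow> pairing f p = 0"
  shows "p \<in> ext_rel scale L n"
  unfolding ext_rel_def
proof (rule in_span_pairingI, rule assms)
  fix f :: "'a list \<Rightarrow> 'b"
  assume *: "pairing f g = 0"
    if "g \<in> multilinear_rels scale L n \<union> {basis_vec xs |xs. xs \<in> words L n \<and> \<not> distinct xs}" for g
  have "f xs = 0" if "xs \<in> words L n" "\<not> distinct xs" for xs
    using *[of "basis_vec xs"] that by auto
  with * show "alternating_on scale L n f"
    by (auto simp: alternating_on_def simp flip: pairing_multilinear_rels_eq_0_iff)
qed

lemma subspace_ext_rel: "free.subspace (ext_rel scale L n)"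
  by (simp add: ext_rel_def)

lemma subspace_tensor_rel: "free.subspace (tensor_rel scale L n)"
  by (simp add: tensor_rel_def)

lemma subspace_sym2_rel: "free.subspace (sym2_rel scale L)"
  by (simp add: sym2_rel_def)

lemma multilinear_on_2:
  "multilinear_on scale L 2 f \<longleftrightarrow>
    (\<forall>x\<in>L. \<forall>y\<in>L. (\<forall>z\<in>L. f [x + z, y] = f [x, y] + f [z, y] \<and> f [x, y + z] = f [x, y] + f [x, z]) \<and>
      (\<forall>c. f [scale c x, y] = c * f [x, y] \<and> f [x, scale c y] = c * f [x, y]))"
  unfolding multilinear_on_def all_words_append_Cons_2 by (simp only: append.simps) blast

lemma multilinear_on_3:
  "multilinear_on scale L 3 f \<longleftrightarrow>
    (\<forall>x\<in>L. \<forall>y\<in>L. \<forall>z\<in>L. (\<forall>w\<in>L. f [x + w, y, z] = f [x, y, z] + f [w, y, z] \<and>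
        f [x, y + w, z] = f [x, y, z] + f [x, w, z] \<and> f [x, y, z + w] = f [x, y, z] + f [x, y, w]) \<and>
      (\<forall>c. f [scale c x, y, z] = c * f [x, y, z] \<and> f [x, scale c y, z] = c * f [x, y, z] \<and>
        f [x, y, scale c z] = c * f [x, y, z]))"
  unfolding multilinear_on_def all_words_append_Cons_3 by (simp only: append.simps) blast

lemma multilinear_on_4:
  "multilinear_on scale L 4 f \<longleftrightarrow>
    (\<forall>x\<in>L. \<forall>y\<in>L. \<forall>z\<in>L. \<forall>u\<in>L. (\<forall>w\<in>L. f [x + w, y, z, u] = f [x, y, z, u] + f [w, y, z, u] \<and>
        f [x, y + w, z, u] = f [x, y, z, u] + f [x, w, z, u] \<and>
        f [x, y, z + w, u] = f [x, y, z, u] + f [x, y, w, u] \<and>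
        f [x, y, z, u + w] = f [x, y, z, u] + f [x, y, z, w]) \<and>
      (\<forall>c. f [scale c x, y, z, u] = c * f [x, y, z, u] \<and> f [x, scale c y, z, u] = c * f [x, y, z, u] \<and>
        f [x, y, scale c z, u] = c * f [x, y, z, u] \<and> f [x, y, z, scale c u] = c * f [x, y, z, u]))"
  unfolding multilinear_on_def all_words_append_Cons_4 by (simp only: append.simps) blast

section \<open>The Chevalley--Eilenberg boundary\<close>

lemma ce_word_3:
  "ce_word br [x, y, z] = basis_vec [br x z, y] - basis_vec [br x y, z] - basis_vec [br y z, x]"
proof -
  have "{(i, j). i < j \<and> j < length [x, y, z]} = {(0, 1), (0, 2), (1, 2)}"
    by (auto simp: less_Suc_eq)
  then show ?thesis
    by (intro poly_mapping_eqI_pairing) (simp add: ce_word_def nths_Cons)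
qed

lemma ce_word_4:
  "ce_word br [x, y, z, w] = basis_vec [br x z, y, w] - basis_vec [br x y, z, w] - basis_vec [br x w, y, z]
    - basis_vec [br y z, x, w] + basis_vec [br y w, x, z] - basis_vec [br z w, x, y]"
proof -
  have "{(i, j). i < j \<and> j < length [x, y, z, w]} = {(0, 1), (0, 2), (0, 3), (1, 2), (1, 3), (2, 3)}"
    by (auto simp: less_Suc_eq numeral_3_eq_3)
  then show ?thesis
    by (intro poly_mapping_eqI_pairing) (simp add: ce_word_def nths_Cons)
qed

context lie_algebra
begin

lemmas mem_L = subspace_0[OF subspace_L] subspace_add[OF subspace_L] subspace_scale[OF subspace_L]
  subspace_neg[OF subspace_L] br_closed

lemma br_antisym:
  assumes "x \<in> L" "y \<in> L"
  shows "br y x = - br x y"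
proof -
  have "br y x + br x y = br (x + y) (x + y)"
    using assms by (simp add: br_add_left br_add_right br_self[of x] br_self[of y] mem_L)
  also have "\<dots> = 0" using assms by (intro br_self mem_L)
  finally show ?thesis by (simp add: eq_neg_iff_add_eq_0)
qed

lemma multilinear_on_2_uminus_zero:
  assumes "multilinear_on scale L 2 f" "x \<in> L" "y \<in> L"
  shows "f [- x, y] = - f [x, y]" "f [x, - y] = - f [x, y]"
    "f [0, y] = 0" "f [x, 0] = 0"
proof -
  have s: "f [scale c x, y] = c * f [x, y]" "f [x, scale c y] = c * f [x, y]" for c
    by (simp_all add: assms(2-3) assms(1)[unfolded multilinear_on_2, rule_format])
  show "f [- x, y] = - f [x, y]" "f [x, - y] = - f [x, y]" "f [0, y] = 0" "f [x, 0] = 0"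
    using s[of "-1"] s[of 0] by simp_all
qed

lemma multilinear_on_3_uminus_zero:
  assumes "multilinear_on scale L 3 f" "x \<in> L" "y \<in> L" "z \<in> L"
  shows "f [- x, y, z] = - f [x, y, z]" "f [0, y, z] = 0"
proof -
  have s: "f [scale c x, y, z] = c * f [x, y, z]" for c
    by (simp add: assms(2-4) assms(1)[unfolded multilinear_on_3, rule_format])
  show "f [- x, y, z] = - f [x, y, z]" "f [0, y, z] = 0"
    using s[of "-1"] s[of 0] by simp_all
qed

text \<open>The transpose of the boundary, i.e. the Chevalley-Eilenberg coboundary, preserves
  alternating functionals; dually, the boundary on words respects \<open>ext_rel\<close>.\<close>

lemma alternating_on_ce_word_3:
  assumes f: "alternating_on scale L 2 f"
  shows "alternating_on scale L 3 (\<lambda>xs. pairing f (ce_word br xs))"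
proof -
  have m: "multilinear_on scale L 2 f" using f by (simp add: alternating_on_def)
  have a: "f [x, x] = 0" if "x \<in> L" for x
    using f that by (simp add: alternating_on_def words_def)
  have alt: "pairing f (ce_word br [x, y, z]) = 0"
    if xyz: "x \<in> L" "y \<in> L" "z \<in> L" "\<not> distinct [x, y, z]" for x y z
  proof -
    consider "x = y" | "x = z" | "y = z" using xyz by auto
    then show ?thesis
    proof cases
      \<comment> \<open>Here \<open>br x z\<close> vanishes and the other two terms cancel by
        antisymmetry; adjacent repetitions cancel without it.\<close>
      case 2
      with xyz br_antisym[of x y] show ?thesis
        by (simp add: ce_word_3 br_self multilinear_on_2_uminus_zero[OF m] mem_L)
    qed (use xyz in \<open>simp_all add: ce_word_3 br_self a multilinear_on_2_uminus_zero[OF m] mem_L\<close>)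
  qed
  have "multilinear_on scale L 3 (\<lambda>xs. pairing f (ce_word br xs))"
    unfolding multilinear_on_3
    by (simp add: ce_word_3 mem_L br_add_left br_add_right br_scale_left br_scale_right
        m[unfolded multilinear_on_2, rule_format] algebra_simps)
  then show ?thesis
    unfolding alternating_on_def Ball_def words_3 using alt by blast
qed

lemma alternating_on_ce_word_4:
  assumes f: "alternating_on scale L 3 f"
  shows "alternating_on scale L 4 (\<lambda>xs. pairing f (ce_word br xs))"
proof -
  have m: "multilinear_on scale L 3 f" using f by (simp add: alternating_on_def)
  have a: "f [x, x, y] = 0" "f [x, y, x] = 0" "f [y, x, x] = 0" if "x \<in> L" "y \<in> L" for x y
    using f that by (simp_all add: alternating_on_def words_def)
  \<comment> \<open>Polarisation in the last two slots; the first slot always holds the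
    bracket.\<close>
  have swap: "f [u, y, x] = - f [u, x, y]" if "x \<in> L" "y \<in> L" "u \<in> L" for x y u
    using a(3)[of "x + y" u] a(3)[of x u] a(3)[of y u] that
    by (simp add: mem_L m[unfolded multilinear_on_3, rule_format] eq_neg_iff_add_eq_0 add.commute)
  have alt: "pairing f (ce_word br [x, y, z, w]) = 0"
    if xyzw: "x \<in> L" "y \<in> L" "z \<in> L" "w \<in> L" "\<not> distinct [x, y, z, w]" for x y z w
  proof -
    consider "x = y" | "x = z" | "x = w" | "y = z" | "y = w" | "z = w" using xyzw by auto
    then show ?thesis
    proof cases
      \<comment> \<open>Repetitions at non-adjacent positions, which are cases 2, 3 and 5, need both
        antisymmetry of the bracket and \<open>swap\<close>.\<close>
      case 2
      with xyzw br_antisym[of x y] swap[of x y "br x w"] show ?thesis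
        by (simp add: ce_word_4 br_self a multilinear_on_3_uminus_zero[OF m] mem_L)
    next
      case 3
      with xyzw br_antisym[of x y] br_antisym[of x z] swap[of x y "br x z"] swap[of x z "br x y"]
      show ?thesis
        by (simp add: ce_word_4 br_self a multilinear_on_3_uminus_zero[OF m] mem_L)
    next
      case 5
      with xyzw br_antisym[of y z] swap[of y z "br x y"] show ?thesis
        by (simp add: ce_word_4 br_self a multilinear_on_3_uminus_zero[OF m] mem_L)
    qed (use xyzw in \<open>simp_all add: ce_word_4 br_self a multilinear_on_3_uminus_zero[OF m] mem_L\<close>)
  qed
  have "multilinear_on scale L 4 (\<lambda>xs. pairing f (ce_word br xs))"
    unfolding multilinear_on_4
    by (simp add: ce_word_4 mem_L br_add_left br_add_right br_scale_left br_scale_right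
        m[unfolded multilinear_on_3, rule_format] algebra_simps)
  then show ?thesis
    unfolding alternating_on_def Ball_def words_4 using alt by blast
qed

text \<open>Relations go to relations because the transpose preserves alternating functionals; hence
  the boundary of a class can be computed on any representative.\<close>

lemma ce_boundary_coset:
  assumes "\<And>f. alternating_on scale L (n - 1) f \<Longrightarrow> alternating_on scale L n (\<lambda>xs. pairing f (ce_word br xs))"
  shows "ce_boundary scale L br n (p +o ext_rel scale L n) =
    lin_ext (ce_word br) p +o ext_rel scale L (n - 1)"
  unfolding ce_boundary_def
proof (rule qmap_coset[OF subspace_ext_rel])
  fix w assume w: "w \<in> ext_rel scale L n"
  have "lin_ext (ce_word br) w \<in> ext_rel scale L (n - 1)"
    by (rule in_ext_relI) (simp add: pairing_ext_rel[OF assms w])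
  then show "lin_ext (ce_word br) (p + w) +o ext_rel scale L (n - 1) =
      lin_ext (ce_word br) p +o ext_rel scale L (n - 1)"
    by (simp add: coset_eq_iff[OF subspace_ext_rel])
qed

end

section \<open>The Killing module and the Koszul map\<close>

definition symmetric_on :: "'v set \<Rightarrow> ('v list \<Rightarrow> 'k) \<Rightarrow> bool"
  where "symmetric_on L f \<longleftrightarrow> (\<forall>x\<in>L. \<forall>y\<in>L. f [x, y] = f [y, x])"

text \<open>Together with multilinearity and symmetry this cuts out the functionals on the Killing
  module.\<close>

definition invariant_on :: "'v set \<Rightarrow> ('v \<Rightarrow> 'v \<Rightarrow> 'v) \<Rightarrow> ('v list \<Rightarrow> 'k) \<Rightarrow> bool"
  where "invariant_on L br f \<longleftrightarrow> (\<forall>x\<in>L. \<forall>y\<in>L. \<forall>z\<in>L. f [br x y, z] = f [x, br y z])"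

lemma subspace_free_on: "free.subspace (free_on X :: ('x \<Rightarrow>\<^sub>0 'k::field) set)"
proof -
  have "(free_on X :: ('x \<Rightarrow>\<^sub>0 'k) set) = {p. \<forall>x. x \<notin> X \<longrightarrow> Poly_Mapping.lookup p x = 0}"
    by (auto simp: free_on_def in_keys_iff)
  then show ?thesis
    by (simp add: free.subspace_def lookup_add)
qed

lemma basis_vec_in_free_on: "x \<in> X \<Longrightarrow> basis_vec x \<in> free_on X"
  by (simp add: free_on_def)

lemma pairing_sym2_rel:
  assumes "multilinear_on scale L 2 f" "symmetric_on L f" "p \<in> sym2_rel scale L"
  shows "pairing f p = 0"
  using _ assms(3) unfolding sym2_rel_def
proof (rule pairing_span)
  show "pairing f g = 0"
    if "g \<in> multilinear_rels scale L 2 \<union> {basis_vec [x, y] - basis_vec [y, x] |x y. x \<in> L \<and> y \<in> L}" for g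
    using assms(1,2) that by (auto simp: symmetric_on_def simp flip: pairing_multilinear_rels_eq_0_iff)
qed

lemma in_sym2_relI:
  assumes "\<And>f. multilinear_on scale L 2 f \<Longrightarrow> symmetric_on L f \<Longrightarrow> pairing f p = 0"
  shows "p \<in> sym2_rel scale L"
  unfolding sym2_rel_def
proof (rule in_span_pairingI, rule assms)
  fix f :: "'a list \<Rightarrow> 'b"
  assume *: "pairing f g = 0"
    if "g \<in> multilinear_rels scale L 2 \<union> {basis_vec [x, y] - basis_vec [y, x] |x y. x \<in> L \<and> y \<in> L}" for g
  then show "multilinear_on scale L 2 f"
    by (auto simp flip: pairing_multilinear_rels_eq_0_iff)
  have "f [x, y] = f [y, x]" if "x \<in> L" "y \<in> L" for x y
    using *[of "basis_vec [x, y] - basis_vec [y, x]"] that by auto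
  then show "symmetric_on L f" by (simp add: symmetric_on_def)
qed

context lie_algebra
begin

definition kill_word :: "'v list \<Rightarrow> ('v list \<Rightarrow>\<^sub>0 'k)"
  where "kill_word xs = basis_vec [br (xs ! 0) (xs ! 1), xs ! 2] - basis_vec [xs ! 0, br (xs ! 1) (xs ! 2)]"

definition koszul_word :: "'v list \<Rightarrow> ('v list \<Rightarrow>\<^sub>0 'k)"
  where "koszul_word xs = basis_vec [xs ! 0, br (xs ! 1) (xs ! 2)]"

text \<open>The preimage of \<open>kill_image\<close> in the free space; with it the twofold
  quotient \<open>Kill\<close> is handled as a single quotient.\<close>

definition kill_rel :: "('v list \<Rightarrow>\<^sub>0 'k) set"
  where "kill_rel = {p. \<exists>q\<in>free_on (words L 3). p - lin_ext kill_word q \<in> sym2_rel scale L}"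

lemma multilinear_on_kill_word:
  assumes "multilinear_on scale L 2 f"
  shows "multilinear_on scale L 3 (\<lambda>xs. pairing f (kill_word xs))"
  unfolding multilinear_on_3
  by (simp add: kill_word_def mem_L br_add_left br_add_right br_scale_left br_scale_right
      assms[unfolded multilinear_on_2, rule_format] algebra_simps)

lemma kill_map_coset:
  "kill_map scale L br (p +o tensor_rel scale L 3) = lin_ext kill_word p +o sym2_rel scale L"
  unfolding kill_map_def kill_word_def[abs_def, symmetric]
proof (rule qmap_coset[OF subspace_tensor_rel])
  fix w assume w: "w \<in> tensor_rel scale L 3"
  have "lin_ext kill_word w \<in> sym2_rel scale L"
  proof (rule in_sym2_relI)
    fix f assume "multilinear_on scale L 2 f"
    from pairing_span[OF _ w[unfolded tensor_rel_def]] multilinear_on_kill_word[OF this]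
    show "pairing f (lin_ext kill_word w) = 0"
      by (simp flip: pairing_multilinear_rels_eq_0_iff)
  qed
  then show "lin_ext kill_word (p + w) +o sym2_rel scale L = lin_ext kill_word p +o sym2_rel scale L"
    by (simp add: coset_eq_iff[OF subspace_sym2_rel])
qed

lemma kill_image_eq:
  "kill_image scale L br = (\<lambda>q. lin_ext kill_word q +o sym2_rel scale L) ` free_on (words L 3)"
  by (simp add: kill_image_def tensor_power_def quot_def image_image kill_map_coset)

lemma coset_plus_kill_image:
  "(a +o sym2_rel scale L) +o kill_image scale L br =
    (\<lambda>q. (a + lin_ext kill_word q) +o sym2_rel scale L) ` free_on (words L 3)"
  by (auto simp: kill_image_eq elt_set_plus_def[of "a +o sym2_rel scale L"]
      coset_plus_coset[OF subspace_sym2_rel])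

lemma subspace_kill_rel: "free.subspace kill_rel"
  unfolding free.subspace_def
proof (intro conjI ballI allI)
  show "0 \<in> kill_rel"
    unfolding kill_rel_def using free.subspace_0[OF subspace_free_on] free.subspace_0[OF subspace_sym2_rel]
    by (auto intro!: bexI[of _ 0])
next
  fix p q assume "p \<in> kill_rel" "q \<in> kill_rel"
  then obtain p' q' where
    "p' \<in> free_on (words L 3)" "p - lin_ext kill_word p' \<in> sym2_rel scale L"
    "q' \<in> free_on (words L 3)" "q - lin_ext kill_word q' \<in> sym2_rel scale L"
    by (auto simp: kill_rel_def)
  with free.subspace_add[OF subspace_free_on, of p' _ q']
    free.subspace_add[OF subspace_sym2_rel, of "p - lin_ext kill_word p'" _ _ "q - lin_ext kill_word q'"]
  show "p + q \<in> kill_rel"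
    unfolding kill_rel_def by (auto intro!: bexI[of _ "p' + q'"] simp: algebra_simps)
next
  fix c p assume "p \<in> kill_rel"
  then obtain p' where
    "p' \<in> free_on (words L 3)" "p - lin_ext kill_word p' \<in> sym2_rel scale L"
    by (auto simp: kill_rel_def)
  with free.subspace_scale[OF subspace_free_on, of p' _ c]
    free.subspace_scale[OF subspace_sym2_rel, of "p - lin_ext kill_word p'" _ _ c]
  show "fscale c p \<in> kill_rel"
    unfolding kill_rel_def by (auto intro!: bexI[of _ "fscale c p'"] simp: free.scale_right_diff_distrib)
qed

text \<open>Invariant symmetric forms descend to the Killing module, so a nonzero value of one
  certifies a nonzero class.\<close>

lemma pairing_kill_rel:
  assumes "multilinear_on scale L 2 f" "symmetric_on L f" "invariant_on L br f" "p \<in> kill_rel"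
  shows "pairing f p = 0"
proof -
  from assms(4) obtain q where q: "q \<in> free_on (words L 3)" "p - lin_ext kill_word q \<in> sym2_rel scale L"
    by (auto simp: kill_rel_def)
  have "pairing (\<lambda>xs. pairing f (kill_word xs)) q = pairing (\<lambda>_. 0) q"
  proof (rule pairing_cong)
    fix xs assume "xs \<in> Poly_Mapping.keys q"
    with q(1) have "xs \<in> words L 3" by (auto simp: free_on_def)
    then show "pairing f (kill_word xs) = 0"
      using assms(3) by (auto simp: words_3 kill_word_def invariant_on_def)
  qed
  then have "pairing f (lin_ext kill_word q) = 0"
    by (simp only: pairing_lin_ext pairing_zero_fun)
  with pairing_sym2_rel[OF assms(1,2) q(2)] show ?thesis
    by (simp only: pairing_diff diff_zero)
qed

text \<open>The double annihilator again: \<open>kill_rel\<close> contains the span of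
  \<open>sym2_rel\<close> and the Killing words, and functionals killing that span are invariant
  symmetric bilinear forms.\<close>

lemma in_kill_relI:
  assumes "\<And>f. multilinear_on scale L 2 f \<Longrightarrow> symmetric_on L f \<Longrightarrow> invariant_on L br f \<Longrightarrow> pairing f p = 0"
  shows "p \<in> kill_rel"
proof -
  let ?S = "sym2_rel scale L \<union> kill_word ` words L 3"
  have "p \<in> free.span ?S"
  proof (rule in_span_pairingI, rule assms)
    fix f assume f: "\<And>g. g \<in> ?S \<Longrightarrow> pairing f g = 0"
    have sub: "multilinear_rels scale L 2 \<union> {basis_vec [x, y] - basis_vec [y, x] |x y. x \<in> L \<and> y \<in> L} \<subseteq> ?S"
      unfolding sym2_rel_def by (meson free.span_superset le_supI1)
    show "multilinear_on scale L 2 f"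
      using f sub by (auto simp flip: pairing_multilinear_rels_eq_0_iff)
    have "f [x, y] = f [y, x]" if "x \<in> L" "y \<in> L" for x y
    proof -
      have "basis_vec [x, y] - basis_vec [y, x] \<in> ?S" using that sub by blast
      from f[OF this] show ?thesis by simp
    qed
    then show "symmetric_on L f" by (simp add: symmetric_on_def)
    have "f [br x y, z] = f [x, br y z]" if "x \<in> L" "y \<in> L" "z \<in> L" for x y z
    proof -
      have "kill_word [x, y, z] \<in> ?S" using that by (auto simp: words_def)
      from f[OF this] show ?thesis by (simp add: kill_word_def)
    qed
    then show "invariant_on L br f" by (simp add: invariant_on_def)
  qed
  also have "free.span ?S \<subseteq> kill_rel"
  proof (rule free.span_minimal[OF _ subspace_kill_rel], rule subsetI)
    fix g assume "g \<in> ?S"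
    then show "g \<in> kill_rel"
    proof
      assume "g \<in> sym2_rel scale L"
      then show ?thesis
        unfolding kill_rel_def using free.subspace_0[OF subspace_free_on]
        by (auto intro!: bexI[of _ 0])
    next
      assume "g \<in> kill_word ` words L 3"
      then obtain xs where "xs \<in> words L 3" "g = kill_word xs" by blast
      then show ?thesis
        unfolding kill_rel_def
        using basis_vec_in_free_on[of xs "words L 3"] free.subspace_0[OF subspace_sym2_rel]
        by (auto intro!: bexI[of _ "basis_vec xs"])
    qed
  qed
  finally show ?thesis .
qed

text \<open>A witness \<open>r\<close> for \<open>a - b\<close> is absorbed by shifting the
  parameter from \<open>q\<close> to \<open>q + r\<close>; the reverse inclusion follows since
  \<open>kill_rel\<close> is closed under negation.\<close>

lemma coset_plus_kill_image_cong:
  assumes "a - b \<in> kill_rel"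
  shows "(a +o sym2_rel scale L) +o kill_image scale L br = (b +o sym2_rel scale L) +o kill_image scale L br"
proof -
  have "(a +o sym2_rel scale L) +o kill_image scale L br \<subseteq> (b +o sym2_rel scale L) +o kill_image scale L br"
    if ab: "a - b \<in> kill_rel" for a b
  proof -
    from ab obtain r where r: "r \<in> free_on (words L 3)" "a - b - lin_ext kill_word r \<in> sym2_rel scale L"
      by (auto simp: kill_rel_def)
    have "(a + lin_ext kill_word q) +o sym2_rel scale L = (b + lin_ext kill_word (q + r)) +o sym2_rel scale L" for q
      using r(2) by (simp add: coset_eq_iff[OF subspace_sym2_rel] algebra_simps)
    then show ?thesis
      unfolding coset_plus_kill_image
      using r(1) free.subspace_add[OF subspace_free_on] by blast
  qed
  from this[OF assms] this[of b a] free.subspace_neg[OF subspace_kill_rel assms] show ?thesis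
    by auto
qed

text \<open>Invariance gives f(x, [x, w]) = f([x, x], w) = 0, and antisymmetry reduces the case
  \<open>x = z\<close> to this. So the Koszul map is defined on the exterior cube.\<close>

lemma alternating_on_koszul_word:
  assumes f: "multilinear_on scale L 2 f" "symmetric_on L f" "invariant_on L br f"
  shows "alternating_on scale L 3 (\<lambda>xs. pairing f (koszul_word xs))"
proof -
  have "multilinear_on scale L 3 (\<lambda>xs. pairing f (koszul_word xs))"
    unfolding multilinear_on_3
    by (simp add: koszul_word_def mem_L br_add_left br_add_right br_scale_left br_scale_right
        f(1)[unfolded multilinear_on_2, rule_format] algebra_simps)
  moreover have "pairing f (koszul_word [x, y, z]) = 0"
    if xyz: "x \<in> L" "y \<in> L" "z \<in> L" "\<not> distinct [x, y, z]" for x y z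
  proof -
    have inv: "f [x, br y z] = f [br x y, z]" "f [x, br y x] = - f [x, br x y]"
      using f(3) xyz br_antisym[of x y] multilinear_on_2_uminus_zero[OF f(1), of x "br x y"]
      by (simp_all add: invariant_on_def mem_L)
    have inv2: "f [x, br x w] = 0" if "w \<in> L" for w
      using f(3) xyz that multilinear_on_2_uminus_zero[OF f(1), of w w] br_self[of x]
      by (metis invariant_on_def)
    consider "x = y" | "x = z" | "y = z" using xyz by auto
    then show ?thesis
      using xyz inv inv2
      by cases (simp_all add: koszul_word_def br_self multilinear_on_2_uminus_zero[OF f(1)])
  qed
  ultimately show ?thesis
    unfolding alternating_on_def Ball_def words_3 by blast
qed

lemma koszul_map_coset:
  "koszul_map scale L br (p +o ext_rel scale L 3) =
    (lin_ext koszul_word p +o sym2_rel scale L) +o kill_image scale L br"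
  unfolding koszul_map_def koszul_word_def[abs_def, symmetric]
proof (rule qmap_coset[OF subspace_ext_rel])
  fix w assume w: "w \<in> ext_rel scale L 3"
  have "lin_ext koszul_word w \<in> kill_rel"
    by (rule in_kill_relI) (simp add: pairing_ext_rel[OF alternating_on_koszul_word w])
  then show "(lin_ext koszul_word (p + w) +o sym2_rel scale L) +o kill_image scale L br =
      (lin_ext koszul_word p +o sym2_rel scale L) +o kill_image scale L br"
    by (intro coset_plus_kill_image_cong) simp
qed

text \<open>
  In the Killing module \<open>[x, y] \<odot> [z, w]\<close> equals \<open>x \<odot> [y, [z, w]]\<close>, so that the Jacobi identity
  makes the image of a boundary vanish.
\<close>

lemma koszul_boundary:
  assumes p: "p \<in> free_on (words L 4)"
  shows "lin_ext koszul_word (lin_ext (ce_word br) p) \<in> kill_rel"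
proof (rule in_kill_relI)
  fix f assume f: "multilinear_on scale L 2 f" "symmetric_on L f" "invariant_on L br f"
  have "pairing (\<lambda>xs. pairing (\<lambda>xs. pairing f (koszul_word xs)) (ce_word br xs)) p = pairing (\<lambda>_. 0) p"
  proof (rule pairing_cong)
    fix xs assume "xs \<in> Poly_Mapping.keys p"
    with p have "xs \<in> words L 4" by (auto simp: free_on_def)
    then obtain x y z w where xs: "xs = [x, y, z, w]" and L: "x \<in> L" "y \<in> L" "z \<in> L" "w \<in> L"
      by (auto simp: words_4)
    note add = f(1)[unfolded multilinear_on_2, rule_format]
    have inv: "f [br a b, br c d] = f [a, br b (br c d)]" if "a \<in> L" "b \<in> L" "c \<in> L" "d \<in> L" for a b c d
      using f(3) that by (simp add: invariant_on_def mem_L)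
    have sym: "f [br a b, br c d] = f [br c d, br a b]" if "a \<in> L" "b \<in> L" "c \<in> L" "d \<in> L" for a b c d
      using f(2) that by (simp add: symmetric_on_def mem_L)
    have "f [x, br y (br z w) + br z (br w y) + br w (br y z)] = 0"
      using L by (simp add: jacobi multilinear_on_2_uminus_zero[OF f(1)])
    then have "f [br x y, br z w] + f [br x z, br w y] + f [br x w, br y z] = 0"
      using L by (simp add: inv add mem_L)
    moreover have "f [br x z, br w y] = - f [br x z, br y w]"
      using L by (simp add: br_antisym[of y w] multilinear_on_2_uminus_zero[OF f(1)] mem_L)
    \<comment> \<open>Symmetry of \<open>f\<close> matches the six boundary terms in pairs, so their
      sum is minus twice the Jacobi sum.\<close>
    moreover have "f [br z w, br x y] = f [br x y, br z w]" "f [br y w, br x z] = f [br x z, br y w]"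
      "f [br y z, br x w] = f [br x w, br y z]"
      by (intro sym L)+
    ultimately have "f [br x z, br y w] - f [br x y, br z w] - f [br x w, br y z] - f [br y z, br x w]
        + f [br y w, br x z] - f [br z w, br x y] = 0"
      by algebra
    then show "pairing (\<lambda>xs. pairing f (koszul_word xs)) (ce_word br xs) = 0"
      by (simp add: xs ce_word_4 koszul_word_def)
  qed
  then show "pairing f (lin_ext koszul_word (lin_ext (ce_word br) p)) = 0"
    by simp
qed

section \<open>Degree three homology and detection of nonzero Koszul classes\<close>

lemmas ce_boundary_coset_3 = ce_boundary_coset[of 3, simplified, OF alternating_on_ce_word_3]
lemmas ce_boundary_coset_4 = ce_boundary_coset[of 4, simplified, OF alternating_on_ce_word_4]

text \<open>This reduces the problem to a chain \<open>p\<close> and a form \<open>f\<close>. The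
  class \<open>h\<close> of \<open>p\<close> has a well-defined Koszul image by
  \<open>koszul_boundary\<close>, and \<open>f\<close> shows that it is nonzero in
  \<open>Kill\<close>.\<close>

lemma reduced_koszul_map_nonzero:
  assumes p: "p \<in> free_on (words L 3)" "lin_ext (ce_word br) p \<in> ext_rel scale L 2"
    and f: "multilinear_on scale L 2 f" "symmetric_on L f" "invariant_on L br f"
    and nz: "pairing f (lin_ext koszul_word p) \<noteq> 0"
  shows "\<exists>h\<in>lie_homology scale L br 3. reduced_koszul_map scale L br h \<noteq> Kill_zero scale L br"
proof -
  define c where "c = p +o ext_rel scale L 3"
  define h where "h = c +o ce_boundaries scale L br 3"
  have zero: "p' +o W = W" if "free.subspace W" "p' \<in> W" for p' :: "'v list \<Rightarrow>\<^sub>0 'k" and W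
    using coset_eq_iff[OF that(1), of p' 0] that(2) by simp
  have "c \<in> ce_cycles scale L br 3"
    using p zero[OF subspace_ext_rel p(2)]
    by (auto simp: ce_cycles_def ext_power_def quot_def c_def ce_boundary_coset_3)
  then have "h \<in> lie_homology scale L br 3"
    by (simp add: lie_homology_def quot_def h_def)
  moreover
  let ?\<eta> = "\<lambda>p. (lin_ext koszul_word p +o sym2_rel scale L) +o kill_image scale L br"
  have bd: "ce_boundaries scale L br 3 =
      (\<lambda>q. lin_ext (ce_word br) q +o ext_rel scale L 3) ` free_on (words L 4)"
    by (simp add: ce_boundaries_def ext_power_def quot_def image_image ce_boundary_coset_4)
  have h: "h = (\<lambda>q. (p + lin_ext (ce_word br) q) +o ext_rel scale L 3) ` free_on (words L 4)"
    unfolding h_def c_def bd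
    by (auto simp: elt_set_plus_def[of "p +o ext_rel scale L 3"] coset_plus_coset[OF subspace_ext_rel])
  have "reduced_koszul_map scale L br h = ?\<eta> p"
    unfolding reduced_koszul_map_def
  \<comment> \<open>\<open>h\<close> is a set of cosets of chains differing by boundaries, and all
    of them have the same Koszul image.\<close>
  proof (rule qmap_eqI)
    show "h \<noteq> {}" using free.subspace_0[OF subspace_free_on, of "words L 4"] by (auto simp: h)
    fix a assume "a \<in> h"
    then obtain q where q: "q \<in> free_on (words L 4)" "a = (p + lin_ext (ce_word br) q) +o ext_rel scale L 3"
      by (auto simp: h)
    have "lin_ext koszul_word (p + lin_ext (ce_word br) q) - lin_ext koszul_word p \<in> kill_rel"
      using koszul_boundary[OF q(1)] by simp
    then show "koszul_map scale L br a = ?\<eta> p"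
      unfolding q(2) koszul_map_coset by (rule coset_plus_kill_image_cong)
  qed
  moreover have "?\<eta> p \<noteq> Kill_zero scale L br"
  proof
    assume "?\<eta> p = Kill_zero scale L br"
    also have "\<dots> = (0 +o sym2_rel scale L) +o kill_image scale L br"
      by (simp add: Kill_zero_def)
    \<comment> \<open>The coset with parameter 0 on the left must occur on the right, which yields
      the witness \<open>q\<close>.\<close>
    finally have "(lin_ext koszul_word p + lin_ext kill_word 0) +o sym2_rel scale L \<in>
        (\<lambda>q. (0 + lin_ext kill_word q) +o sym2_rel scale L) ` free_on (words L 3)"
      unfolding coset_plus_kill_image using free.subspace_0[OF subspace_free_on] by blast
    then obtain q where "q \<in> free_on (words L 3)"
      "lin_ext koszul_word p - lin_ext kill_word q \<in> sym2_rel scale L"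
      by (auto simp: coset_eq_iff[OF subspace_sym2_rel])
    then have "lin_ext koszul_word p \<in> kill_rel"
      by (auto simp: kill_rel_def)
    with nz show False using pairing_kill_rel[OF f] by blast
  qed
  ultimately show ?thesis by auto
qed

end

section \<open>The Lie algebra of the Fano plane\<close>

text \<open>
  \<open>e\<^sub>0, \<dots>, e\<^sub>6\<close> is a basis of \<open>V\<close> and \<open>e\<^sub>7, \<dots>, e\<^sub>1\<^sub>3\<close> the dual basis of \<open>V\<^sup>*\<close>; the
  remaining basis vectors are central and play no role. The lines of the
  Fano plane are \<open>{i, i + 1, i + 3}\<close> modulo 7, those through \<open>c\<close> being \<open>{c, c + 1, c + 3}\<close>,
  \<open>{c, c + 2, c + 6}\<close> and \<open>{c, c + 4, c + 5}\<close>.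
\<close>

definition fano_coord :: "(nat \<Rightarrow>\<^sub>0 'k::field) \<Rightarrow> (nat \<Rightarrow>\<^sub>0 'k) \<Rightarrow> nat \<Rightarrow> 'k"
  where "fano_coord x y c = (\<Sum>(i, j)\<in>{(1, 3), (2, 6), (4, 5)}.
    Poly_Mapping.lookup x ((c + i) mod 7) * Poly_Mapping.lookup y ((c + j) mod 7) -
    Poly_Mapping.lookup x ((c + j) mod 7) * Poly_Mapping.lookup y ((c + i) mod 7))"

text \<open>\<open>fano_coord x y c\<close> is \<tau>(x, y, e_c): each pair \<open>(i, j)\<close>
  there is ordered so that (c, c + i, c + j) is a cyclic rotation of an oriented line. The shift by
  7 moves the result into the dual space.\<close>

definition fano_bracket :: "(nat \<Rightarrow>\<^sub>0 'k::field) \<Rightarrow> (nat \<Rightarrow>\<^sub>0 'k) \<Rightarrow> (nat \<Rightarrow>\<^sub>0 'k)"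
  where "fano_bracket x y = (\<Sum>c<7. Poly_Mapping.single (7 + c) (fano_coord x y c))"

definition fano_form :: "(nat \<Rightarrow>\<^sub>0 'k::field) list \<Rightarrow> 'k"
  where "fano_form xs = (\<Sum>c<7.
    Poly_Mapping.lookup (xs ! 0) c * Poly_Mapping.lookup (xs ! 1) (7 + c) +
    Poly_Mapping.lookup (xs ! 0) (7 + c) * Poly_Mapping.lookup (xs ! 1) c)"

definition fano_cycle :: "(nat \<Rightarrow>\<^sub>0 'k::field) list \<Rightarrow>\<^sub>0 'k"
  where "fano_cycle = (\<Sum>i<7. basis_vec [basis_vec i, basis_vec (Suc i mod 7), basis_vec ((i + 3) mod 7)])"

lemma sum_lessThan_7: "(\<Sum>c<7. g c) = g 0 + g 1 + g 2 + g 3 + g 4 + g 5 + g (6::nat)"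
  by (simp add: eval_nat_numeral)

lemma lookup_fano_bracket:
  "Poly_Mapping.lookup (fano_bracket x y) k = (\<Sum>c<7. fano_coord x y c when 7 + c = k)"
  by (simp add: fano_bracket_def lookup_sum lookup_single)

lemma lookup_fano_bracket_low: "k < 7 \<Longrightarrow> Poly_Mapping.lookup (fano_bracket x y) k = 0"
  by (simp add: lookup_fano_bracket)

lemma lookup_fano_bracket_high: "c < 7 \<Longrightarrow> Poly_Mapping.lookup (fano_bracket x y) (7 + c) = fano_coord x y c"
  by (simp add: lookup_fano_bracket when_def)

lemma fano_coord_high:
  assumes "\<And>k. k < 7 \<Longrightarrow> Poly_Mapping.lookup y k = 0"
  shows "fano_coord x y c = 0"
  by (simp add: fano_coord_def assms)

lemma fano_bracket_high:
  assumes "\<And>k. k < 7 \<Longrightarrow> Poly_Mapping.lookup y k = 0"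
  shows "fano_bracket x y = 0"
  by (simp add: fano_bracket_def fano_coord_high[OF assms])

text \<open>Brackets read only the coordinates below 7 and produce none of them.\<close>

lemma fano_bracket_fano_bracket: "fano_bracket x (fano_bracket y z) = 0"
  by (intro fano_bracket_high lookup_fano_bracket_low)

lemma lie_algebra_fano: "lie_algebra (fscale :: 'k::field \<Rightarrow> _) UNIV fano_bracket"
proof
  fix x y z :: "nat \<Rightarrow>\<^sub>0 'k" and c :: 'k
  show "fano_bracket (x + y) z = fano_bracket x z + fano_bracket y z"
    "fano_bracket x (y + z) = fano_bracket x y + fano_bracket x z"
    by (simp_all add: fano_bracket_def fano_coord_def lookup_add algebra_simps flip: sum.distrib single_add)
  show "fano_bracket (fscale c x) y = fscale c (fano_bracket x y)"
    "fano_bracket x (fscale c y) = fscale c (fano_bracket x y)"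
    by (rule poly_mapping_eqI; simp add: lookup_fano_bracket fano_coord_def sum_distrib_left
        when_def algebra_simps if_distrib cong: if_cong)+
  show "fano_bracket x x = 0"
    by (simp add: fano_bracket_def fano_coord_def)
\<comment> \<open>Each summand of the Jacobi identity is a double bracket.\<close>
qed (simp_all add: fano_bracket_fano_bracket)

interpretation fano: lie_algebra fscale UNIV fano_bracket
  by (rule lie_algebra_fano)

lemma lie_product_fano:
  "lie_product (fscale :: 'k::field \<Rightarrow> _) fano_bracket UNIV (lie_product fscale fano_bracket UNIV UNIV) = {0}"
proof -
  let ?D = "lie_product (fscale :: 'k \<Rightarrow> _) fano_bracket UNIV UNIV"
  have "Poly_Mapping.lookup y k = 0" if "y \<in> ?D" "k < 7" for y k
    using that(1) unfolding lie_product_def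
    by (induction rule: free.span_induct_alt)
      (auto simp: lookup_add lookup_fano_bracket_low that(2))
  then have zero: "fano_bracket x y = 0" if "y \<in> ?D" for x y
    using that by (intro fano_bracket_high)
  \<comment> \<open>A member of \<open>?D\<close> ensures that the set of brackets is
    \<open>{0}\<close> and not empty.\<close>
  have "0 \<in> ?D"
    by (simp add: lie_product_def free.span_zero)
  with zero have "{fano_bracket x y | x y. x \<in> UNIV \<and> y \<in> ?D} = {0}"
    by (auto intro!: exI[of _ 0])
  then show ?thesis
    unfolding lie_product_def[of _ _ _ ?D] by simp
qed

section \<open>The invariant form and the cycle of lines\<close>

lemma multilinear_on_fano_form: "multilinear_on fscale UNIV 2 fano_form"
  unfolding multilinear_on_2
  by (simp add: fano_form_def lookup_add sum_distrib_left algebra_simps flip: sum.distrib)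

lemma symmetric_on_fano_form: "symmetric_on UNIV fano_form"
  by (simp add: symmetric_on_def fano_form_def algebra_simps)

text \<open>Both sides equal \<tau>(x, y, z), by the cyclic symmetry of \<tau>.\<close>

lemma invariant_on_fano_form: "invariant_on UNIV fano_bracket (fano_form :: _ \<Rightarrow> 'k::field)"
proof -
  have form: "fano_form [fano_bracket x y, z] = (\<Sum>c<7. fano_coord x y c * Poly_Mapping.lookup z c)"
    "fano_form [x, fano_bracket y z] = (\<Sum>c<7. Poly_Mapping.lookup x c * fano_coord y z c)"
    for x y z :: "nat \<Rightarrow>\<^sub>0 'k"
    by (simp_all add: fano_form_def lookup_fano_bracket_low lookup_fano_bracket_high)
  show ?thesis
    unfolding invariant_on_def form by (simp add: sum_lessThan_7 fano_coord_def algebra_simps flip: numeral_2_eq_2)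
qed

text \<open>Two points lie on exactly one line, so only the dual vector of the third point survives;
  the cyclic order keeps all signs positive.\<close>

lemma fano_bracket_line:
  assumes "i < 7"
  shows "fano_bracket (basis_vec i) (basis_vec (Suc i mod 7)) = (basis_vec (7 + (i + 3) mod 7) :: _ \<Rightarrow>\<^sub>0 'k::field)"
    and "fano_bracket (basis_vec (Suc i mod 7)) (basis_vec ((i + 3) mod 7)) = (basis_vec (7 + i) :: _ \<Rightarrow>\<^sub>0 'k)"
    and "fano_bracket (basis_vec ((i + 3) mod 7)) (basis_vec i) = (basis_vec (7 + Suc i mod 7) :: _ \<Rightarrow>\<^sub>0 'k)"
proof -
  consider "i = 0" | "i = 1" | "i = 2" | "i = 3" | "i = 4" | "i = 5" | "i = 6" using assms by linarith
  note cases = this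
  show "fano_bracket (basis_vec i) (basis_vec (Suc i mod 7)) = (basis_vec (7 + (i + 3) mod 7) :: _ \<Rightarrow>\<^sub>0 'k)"
    \<comment> \<open>The rule \<open>single_one\<close> would rewrite the basis vector of index 0
      to the ring unit \<open>1\<close>.\<close>
    by (rule cases) (simp_all add: fano_bracket_def sum_lessThan_7 fano_coord_def lookup_single del: single_one)
  show "fano_bracket (basis_vec (Suc i mod 7)) (basis_vec ((i + 3) mod 7)) = (basis_vec (7 + i) :: _ \<Rightarrow>\<^sub>0 'k)"
    by (rule cases) (simp_all add: fano_bracket_def sum_lessThan_7 fano_coord_def lookup_single del: single_one)
  show "fano_bracket (basis_vec ((i + 3) mod 7)) (basis_vec i) = (basis_vec (7 + Suc i mod 7) :: _ \<Rightarrow>\<^sub>0 'k)"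
    by (rule cases) (simp_all add: fano_bracket_def sum_lessThan_7 fano_coord_def lookup_single del: single_one)
qed

lemma fano_cycle_in_free_on: "fano_cycle \<in> free_on (words UNIV 3)"
  unfolding fano_cycle_def
  by (intro free.subspace_sum[OF subspace_free_on] basis_vec_in_free_on) (simp add: words_def)

lemma ce_boundary_fano_cycle:
  assumes "(3::'k::field) = 0"
  shows "lin_ext (ce_word fano_bracket) fano_cycle \<in> ext_rel (fscale :: 'k \<Rightarrow> _) UNIV 2"
proof (rule in_ext_relI)
  fix f :: "(nat \<Rightarrow>\<^sub>0 'k) list \<Rightarrow> 'k" assume "alternating_on fscale UNIV 2 f"
  then have m: "multilinear_on fscale UNIV 2 f" by (simp add: alternating_on_def)
  let ?g = "\<lambda>i. f [basis_vec (7 + i), basis_vec i]"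
  \<comment> \<open>In \<open>ce_word_3\<close> the term with \<open>br x z\<close> has a plus sign
    but runs against the cyclic order, so all three contributions are negative.\<close>
  have "pairing f (ce_word fano_bracket [basis_vec i, basis_vec (Suc i mod 7), basis_vec ((i + 3) mod 7)]) =
      - (?g i + ?g (Suc i mod 7) + ?g ((i + 3) mod 7))" if "i < 7" for i
    by (simp add: ce_word_3 fano_bracket_line[OF that] fano.multilinear_on_2_uminus_zero[OF m]
        fano.br_antisym[of "basis_vec ((i + 3) mod 7)" "basis_vec i"])
  then have "pairing f (lin_ext (ce_word fano_bracket) fano_cycle) =
      - (\<Sum>i<7. ?g i + ?g (Suc i mod 7) + ?g ((i + 3) mod 7))"
    by (simp add: fano_cycle_def sum_negf del: minus_add_distrib)
  \<comment> \<open>The shifts by 1 and 3 permute the residues modulo 7: each point is counted once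
    for each of its three lines.\<close>
  also have "\<dots> = - (3 * (\<Sum>i<7. ?g i))"
    by (simp add: sum_lessThan_7 algebra_simps flip: numeral_2_eq_2)
  finally show "pairing f (lin_ext (ce_word fano_bracket) fano_cycle) = 0"
    by (simp add: assms)
qed

text \<open>For each of the seven lines, the Koszul word pairs a basis vector with its own dual
  vector.\<close>

lemma fano_form_koszul: "pairing fano_form (lin_ext fano.koszul_word fano_cycle) = (7::'k::field)"
proof -
  have "fano_form [basis_vec i, basis_vec (7 + i)] = (1::'k)" if "i < 7" for i
  proof -
    have "i \<in> {0, 1, 2, 3, 4, 5, 6}" using that by auto
    then show ?thesis by (auto simp: fano_form_def sum_lessThan_7 lookup_single)
  qed
  then show ?thesis
    by (simp add: fano_cycle_def fano.koszul_word_def fano_bracket_line)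
qed

theorem proposition3p8:
  assumes "CHAR('k::field) = 3"
  shows "\<exists>(scale :: 'k \<Rightarrow> (nat \<Rightarrow>\<^sub>0 'k) \<Rightarrow> (nat \<Rightarrow>\<^sub>0 'k)) L br.
    lie_algebra scale L br \<and>
    lie_product scale br L (lie_product scale br L L) = {0} \<and>
    (\<exists>h \<in> lie_homology scale L br 3. reduced_koszul_map scale L br h \<noteq> Kill_zero scale L br)"
proof -
  have three: "(3::'k) = 0"
    using of_nat_CHAR[where ?'a = 'k] by (simp add: assms)
  \<comment> \<open>This form exposes the literal 3, which \<open>three\<close> turns into
    0.\<close>
  have "(7::'k) = 2 * 3 + 1" by simp
  then have "(7::'k) \<noteq> 0" unfolding three by simp
  then have "\<exists>h\<in>lie_homology (fscale :: 'k \<Rightarrow> _) UNIV fano_bracket 3.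
      reduced_koszul_map fscale UNIV fano_bracket h \<noteq> Kill_zero fscale UNIV fano_bracket"
    by (intro fano.reduced_koszul_map_nonzero[OF fano_cycle_in_free_on ce_boundary_fano_cycle[OF three]
          multilinear_on_fano_form symmetric_on_fano_form invariant_on_fano_form])
      (simp only: fano_form_koszul not_False_eq_True)
  with lie_algebra_fano lie_product_fano show ?thesis by blast
qed

end
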